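(* Let $\mathcal A$ be a finite set of $m\ge 2$ alternatives, $0<\varphi<1$, $n\ge 1$, and consider Mallows' model with dispersion $\varphi$ and $n$ i.i.d. rankings. Let $a\in\mathcal A$, let $h_1\in\mathcal L(\mathcal A)$ be a ranking in which $a$ is not ranked at the top, and let $0<\alpha<1$. Let $B$ be the set of alternatives ranked above $a$ in $h_1$. Then the following test is a level-$\alpha$ uniformly most powerful test for $H_0=L_{a\succ\text{others}}$ vs. $H_1=\{h_1\}$: for every $n$-profile $P_n$, $$f_{\alpha,a,B}(P_n)=\begin{cases}1&\text{if }w_{P_n}(B\succ a)>K_\alpha\\ 0&\text{if }w_{P_n}(B\succ a)<K_\alpha\\ \Gamma_\alpha&\text{if }w_{P_n}(B\succ a)=K_\alpha,\end{cases}$$ where $K_\alpha\in\mathbb R$ and $\Gamma_\alpha\in[0,1]$ are chosen such that the size of $f_{\alpha,a,B}$ (with respect to $H_0$) is $\alpha$.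
   Context: $\mathcal L(\mathcal A)$ is the set of all linear orders (rankings) over $\mathcal A$; $b\succ_V c$ means $b$ is preferred to $c$ in $V$. $L_{a\succ\text{others}}=\{V\in\mathcal L(\mathcal A): a\succ_V b\text{ for all }b\ne a\}$. The Kendall-tau distance $\mathrm{KT}(V,W)$ is the number of unordered pairs of alternatives on which $V$ and $W$ disagree. Mallows' model with fixed dispersion $\varphi$: sample space $\mathcal L(\mathcal A)^n$, parameter space $\mathcal L(\mathcal A)$; given parameter $W$, the $n$ rankings are i.i.d. with $\pi_W(V)=\frac1Z\varphi^{\mathrm{KT}(V,W)}$, $Z$ the normalization factor. An $n$-profile $P$ is an element of $\mathcal L(\mathcal A)^n$; $P(b\succ c)$ is the number of votes in $P$ in which $b$ is preferred to $c$; $w_P(b\succ c)=P(b\succ c)-P(c\succ b)$; for $B\subseteq\mathcal A\setminus\{a\}$, $w_P(B\succ a)=\sum_{b\in B}w_P(b\succ a)$. Testing: for disjoint sets of parameters $H_0,H_1$, a (randomized) test is a function $f$ from the sample space to $[0,1]$ ($f(P)$ is the probability of rejecting $H_0$). $\mathrm{Size}(f,h_0)=E_{P\sim\pi_{h_0}}f(P)$, $\mathrm{Size}(f)=\sup_{h_0\in H_0}\mathrm{Size}(f,h_0)$, and $\mathrm{Power}(f,h_1)=E_{P\sim\pi_{h_1}}f(P)$ for $h_1\in H_1$. A level-$\alpha$ uniformly most powerful (UMP) test for $H_0$ vs. $H_1$ is a test $f$ with $\mathrm{Size}(f)=\alpha$ such that for every $h_1\in H_1$ and every test $g$ with $\mathrm{Size}(g)\le\alpha$,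 $\mathrm{Power}(f,h_1)\ge\mathrm{Power}(g,h_1)$. *)

theory Defs
  imports "HOL-Probability.Probability"
begin

text \<open>
  A ranking is a reflexive linear order in the sense of the library; a pair \<open>(b, c)\<close> of distinct
  alternatives belongs to the relation when \<open>b\<close> is ranked above (preferred to) \<open>c\<close>.
\<close>

definition rankings :: "'a set \<Rightarrow> 'a rel set" where
  "rankings A = {V. linear_order_on A V}"

definition prefers :: "'a rel \<Rightarrow> 'a \<Rightarrow> 'a \<Rightarrow> bool" where
  "prefers V b c \<longleftrightarrow> b \<noteq> c \<and> (b, c) \<in> V"

definition top_rankings :: "'a set \<Rightarrow> 'a \<Rightarrow> 'a rel set" where
  "top_rankings A a = {V \<in> rankings A. \<forall>b\<in>A. b \<noteq> a \<longrightarrow> prefers V a b}"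

definition profiles :: "'a set \<Rightarrow> nat \<Rightarrow> 'a rel list set" where
  "profiles A n = {P. set P \<subseteq> rankings A \<and> length P = n}"

definition votes :: "'a rel list \<Rightarrow> 'a \<Rightarrow> 'a \<Rightarrow> nat" where
  "votes P b c = length (filter (\<lambda>V. prefers V b c) P)"

definition margin :: "'a rel list \<Rightarrow> 'a \<Rightarrow> 'a \<Rightarrow> int" where
  "margin P b c = int (votes P b c) - int (votes P c b)"

definition set_margin :: "'a rel list \<Rightarrow> 'a set \<Rightarrow> 'a \<Rightarrow> int" where
  "set_margin P B a = (\<Sum>b\<in>B. margin P b a)"

text \<open>The pairs counted here are unordered, hence the two-element sets.\<close>

definition kendall_tau :: "'a rel \<Rightarrow> 'a rel \<Rightarrow> nat" where
  "kendall_tau V W = card {{b, c} | b c. prefers V b c \<and> prefers W c b}"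

definition mallows_Z :: "'a set \<Rightarrow> real \<Rightarrow> 'a rel \<Rightarrow> real" where
  "mallows_Z A \<phi> W = (\<Sum>V\<in>rankings A. \<phi> ^ kendall_tau V W)"

definition mallows :: "'a set \<Rightarrow> real \<Rightarrow> 'a rel \<Rightarrow> 'a rel pmf" where
  "mallows A \<phi> W =
     embed_pmf (\<lambda>V. if V \<in> rankings A then \<phi> ^ kendall_tau V W / mallows_Z A \<phi> W else 0)"

definition mallows_model :: "'a set \<Rightarrow> real \<Rightarrow> nat \<Rightarrow> 'a rel \<Rightarrow> 'a rel list pmf" where
  "mallows_model A \<phi> n W = replicate_pmf n (mallows A \<phi> W)"

lemma finite_rankings: "finite A \<Longrightarrow> finite (rankings A)"
  by (rule finite_subset[of _ "Pow (A \<times> A)"]) (auto simp: rankings_def order_on_defs)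

text \<open>The function passed to \<open>embed_pmf\<close> is a probability mass function.\<close>

lemma pmf_mallows:
  assumes "finite A" "\<phi> > 0" "W \<in> rankings A"
  shows "pmf (mallows A \<phi> W) V =
           (if V \<in> rankings A then \<phi> ^ kendall_tau V W / mallows_Z A \<phi> W else 0)"
proof -
  let ?f = "\<lambda>V. if V \<in> rankings A then \<phi> ^ kendall_tau V W / mallows_Z A \<phi> W else 0"
  have fin: "finite (rankings A)" using assms(1) by (rule finite_rankings)
  have Z: "mallows_Z A \<phi> W > 0"
    unfolding mallows_Z_def using assms fin by (intro sum_pos) auto
  have nn: "?f U \<ge> 0" for U using assms(2) Z by simp
  have "(\<integral>\<^sup>+U. ennreal (?f U) \<partial>count_space UNIV)
      = (\<Sum>U\<in>rankings A. ennreal (?f U))"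
    using fin by (intro nn_integral_count_space'[of "rankings A"]) auto
  also have "\<dots> = ennreal (\<Sum>U\<in>rankings A. ?f U)"
    using assms(2) Z by (intro sum_ennreal) auto
  also have "(\<Sum>U\<in>rankings A. ?f U) = 1"
  proof -
    have "(\<Sum>U\<in>rankings A. ?f U) = (\<Sum>U\<in>rankings A. \<phi> ^ kendall_tau U W) / mallows_Z A \<phi> W"
      unfolding sum_divide_distrib by (intro sum.cong) auto
    then show ?thesis using Z unfolding mallows_Z_def[symmetric] by simp
  qed
  finally show ?thesis
    unfolding mallows_def by (intro pmf_embed_pmf nn) simp
qed

text \<open>
  A statistical model is a family \<open>\<pi>\<close> of distributions indexed by parameters, with sample space
  \<open>S\<close>; a test is only constrained on \<open>S\<close>, which is meant to contain the support of each \<open>\<pi> h\<close>.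
\<close>

definition is_test :: "'s set \<Rightarrow> ('s \<Rightarrow> real) \<Rightarrow> bool" where
  "is_test S f \<longleftrightarrow> (\<forall>P\<in>S. 0 \<le> f P \<and> f P \<le> 1)"

definition size_at :: "('p \<Rightarrow> 's pmf) \<Rightarrow> ('s \<Rightarrow> real) \<Rightarrow> 'p \<Rightarrow> real" where
  "size_at \<pi> f h\<^sub>0 = measure_pmf.expectation (\<pi> h\<^sub>0) f"

definition test_size :: "('p \<Rightarrow> 's pmf) \<Rightarrow> 'p set \<Rightarrow> ('s \<Rightarrow> real) \<Rightarrow> real" where
  "test_size \<pi> H\<^sub>0 f = (SUP h\<^sub>0\<in>H\<^sub>0. size_at \<pi> f h\<^sub>0)"

definition power_at :: "('p \<Rightarrow> 's pmf) \<Rightarrow> ('s \<Rightarrow> real) \<Rightarrow> 'p \<Rightarrow> real" where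
  "power_at \<pi> f h\<^sub>1 = measure_pmf.expectation (\<pi> h\<^sub>1) f"

definition ump_test ::
  "'s set \<Rightarrow> ('p \<Rightarrow> 's pmf) \<Rightarrow> 'p set \<Rightarrow> 'p set \<Rightarrow> real \<Rightarrow> ('s \<Rightarrow> real) \<Rightarrow> bool" where
  "ump_test S \<pi> H\<^sub>0 H\<^sub>1 \<alpha> f \<longleftrightarrow>
     H\<^sub>0 \<inter> H\<^sub>1 = {} \<and> is_test S f \<and> test_size \<pi> H\<^sub>0 f = \<alpha> \<and>
     (\<forall>h\<^sub>1\<in>H\<^sub>1. \<forall>g. is_test S g \<and> test_size \<pi> H\<^sub>0 g \<le> \<alpha> \<longrightarrow>
        power_at \<pi> f h\<^sub>1 \<ge> power_at \<pi> g h\<^sub>1)"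

definition margin_test :: "'a \<Rightarrow> 'a set \<Rightarrow> real \<Rightarrow> real \<Rightarrow> 'a rel list \<Rightarrow> real" where
  "margin_test a B K \<Gamma> P =
     (if real_of_int (set_margin P B a) > K then 1
      else if real_of_int (set_margin P B a) < K then 0
      else \<Gamma>)"

end

theory Submission
  imports Defs "HOL-Combinatorics.Transposition"
begin

text \<open>
  Although the null hypothesis is composite, one of its rankings is least favourable: the ranking
  \<open>h\<^sub>0\<close> obtained from \<open>h\<^sub>1\<close> by lifting \<open>a\<close> to the top and leaving the other alternatives in place
  (\<open>raise_top\<close>). Two facts about \<open>h\<^sub>0\<close> give the theorem.

  First, \<open>h\<^sub>0\<close> and \<open>h\<^sub>1\<close> differ only on the pairs \<open>{b, a}\<close> with \<open>b \<in> B\<close>, so for a single vote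
  \<open>KT(V, h\<^sub>0) - KT(V, h\<^sub>1)\<close> is the margin of \<open>B\<close> over \<open>a\<close> in \<open>V\<close> (\<open>kendall_tau_raise_top\<close>). The
  likelihood ratio of a profile \<open>P\<close> is therefore a positive constant times \<open>\<phi>\<close> to the power
  \<open>-w\<^sub>P(B \<succ> a)\<close> (\<open>mallows_model_likelihood_ratio\<close>), which increases with the margin because
  \<open>\<phi> < 1\<close>. By the Neyman--Pearson lemma (\<open>neyman_pearson\<close>) a margin test is most powerful for
  \<open>h\<^sub>0\<close> against \<open>h\<^sub>1\<close> among the tests whose size at \<open>h\<^sub>0\<close> does not exceed its own.

  Second, the margin is stochastically largest under \<open>h\<^sub>0\<close> among all rankings with \<open>a\<close> on top, so
  the size of a margin test is its size at \<open>h\<^sub>0\<close> (\<open>test_size_margin_test\<close>). For one vote this is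
  shown by sorting: a ranking \<open>h \<noteq> h\<^sub>0\<close> with \<open>a\<close> on top has two neighbours \<open>x\<close>, \<open>y\<close> on whose order
  \<open>h\<close> and \<open>h\<^sub>0\<close> disagree (\<open>adjacent_disagreement\<close>). As \<open>h\<^sub>0\<close> ranks \<open>B\<close> directly below \<open>a\<close>, the
  exchange never moves a member of \<open>B\<close> below a non-member, and exchanging \<open>x\<close> and \<open>y\<close> in every
  vote shows that no expectation of a nondecreasing function of the margin goes down
  (\<open>expectation_mallows_adjacent_swap_le\<close>). Each exchange brings \<open>h\<close> closer to \<open>h\<^sub>0\<close>, so finitely
  many of them suffice. Stochastic dominance of one vote passes to the sum over independent votes
  (\<open>expectation_replicate_pmf_stochastic_mono\<close>).

  A test whose size at every null ranking is at most \<open>\<alpha>\<close> has size at most \<open>\<alpha>\<close> at \<open>h\<^sub>0\<close>, hence no more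
  power than the margin test of size exactly \<open>\<alpha>\<close>. A critical value and a randomisation that attain
  \<open>\<alpha>\<close> exist because the margin takes finitely many integer values (\<open>ex_critical_value\<close>).
\<close>

section \<open>Rankings and discordant pairs\<close>

lemma prefers_in:
  assumes "V \<in> rankings A" "prefers V b c"
  shows "b \<in> A" "c \<in> A"
  using assms by (auto simp: rankings_def prefers_def order_on_defs)

lemma prefers_irrefl: "\<not> prefers V b b"
  by (simp add: prefers_def)

lemma prefers_asym:
  assumes "V \<in> rankings A" "prefers V b c"
  shows "\<not> prefers V c b"
  using assms by (auto simp: rankings_def prefers_def order_on_defs dest: antisymD)

lemma prefers_total:
  assumes "V \<in> rankings A" "b \<in> A" "c \<in> A" "b \<noteq> c"
  shows "prefers V b c \<or> prefers V c b"
  using assms by (auto simp: rankings_def prefers_def order_on_defs total_on_def)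

lemma prefers_trans:
  assumes "V \<in> rankings A" "prefers V b c" "prefers V c d"
  shows "prefers V b d"
proof -
  have "(b, d) \<in> V"
    using assms by (auto simp: rankings_def prefers_def order_on_defs dest: transD)
  moreover have "b \<noteq> d"
    using prefers_asym[OF assms(1,2)] assms(3) by auto
  ultimately show ?thesis by (simp add: prefers_def)
qed

lemma rankings_eqI:
  assumes V: "V \<in> rankings A" and W: "W \<in> rankings A"
    and sub: "\<And>b c. prefers V b c \<Longrightarrow> prefers W b c"
  shows "V = W"
proof -
  have iff: "prefers V b c \<longleftrightarrow> prefers W b c" for b c
  proof
    assume "prefers W b c"
    then show "prefers V b c"
      using prefers_total[OF V, of b c] prefers_in[OF W] sub prefers_asym[OF W]
      by (metis prefers_def)
  qed (rule sub)
  have "(b, c) \<in> V \<longleftrightarrow> (b, c) \<in> W" for b c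
  proof (cases "b = c")
    case True
    with V W show ?thesis
      by (auto simp: rankings_def order_on_defs refl_on_def)
  next
    case False
    with iff[of b c] show ?thesis by (simp add: prefers_def)
  qed
  then show ?thesis by auto
qed

text \<open>
  The unordered pairs behind the Kendall-tau distance, each oriented the way the first ranking
  orders it; swapping neighbours and lifting an alternative then become set equations.
\<close>

definition discordant :: "'a rel \<Rightarrow> 'a rel \<Rightarrow> ('a \<times> 'a) set" where
  "discordant V W = {(b, c). prefers V b c \<and> prefers W c b}"

lemma finite_discordant:
  assumes "finite A" "V \<in> rankings A"
  shows "finite (discordant V W)"
  by (rule finite_subset[of _ "A \<times> A"])
    (use assms in \<open>auto simp: discordant_def dest: prefers_in\<close>)

lemma kendall_tau_eq_card_discordant:
  assumes V: "V \<in> rankings A"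
  shows "kendall_tau V W = card (discordant V W)"
proof -
  have "{{b, c} | b c. prefers V b c \<and> prefers W c b}
      = (\<lambda>(b, c). {b, c}) ` discordant V W"
    by (auto simp: discordant_def)
  moreover have "inj_on (\<lambda>(b, c). {b, c}) (discordant V W)"
    using prefers_asym[OF V] by (auto simp: inj_on_def discordant_def doubleton_eq_iff)
  ultimately show ?thesis
    by (simp add: kendall_tau_def card_image)
qed

section \<open>Margins\<close>

lemma margin_Nil [simp]: "margin [] b c = 0"
  by (simp add: margin_def votes_def)

lemma margin_Cons: "margin (V # P) b c = of_bool (prefers V b c) - of_bool (prefers V c b) + margin P b c"
  by (simp add: margin_def votes_def)

lemma set_margin_Nil [simp]: "set_margin [] B a = 0"
  by (simp add: set_margin_def)

lemma set_margin_Cons: "set_margin (V # P) B a = set_margin [V] B a + set_margin P B a"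
  by (simp add: set_margin_def margin_Cons sum.distrib)

section \<open>The least favourable ranking\<close>

definition raise_top :: "'a set \<Rightarrow> 'a \<Rightarrow> 'a rel \<Rightarrow> 'a rel" where
  "raise_top A a W = {(b, c) \<in> W. c \<noteq> a} \<union> {a} \<times> A"

lemma prefers_raise_top:
  "prefers (raise_top A a W) b c \<longleftrightarrow> b \<noteq> c \<and> c \<noteq> a \<and> (b = a \<and> c \<in> A \<or> prefers W b c)"
  by (auto simp: prefers_def raise_top_def)

lemma raise_top_in_top_rankings:
  assumes W: "W \<in> rankings A" and a: "a \<in> A"
  shows "raise_top A a W \<in> top_rankings A a"
proof -
  have "linear_order_on A (raise_top A a W)"
    using W a
    unfolding rankings_def raise_top_def order_on_defs
    by (auto simp: refl_on_def total_on_def antisym_def intro!: transI dest: transD)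
  then show ?thesis
    by (auto simp: top_rankings_def rankings_def prefers_raise_top)
qed

text \<open>
  Lifting \<open>a\<close> over \<open>B\<close> creates a disagreement with each vote that prefers some \<open>b \<in> B\<close> to \<open>a\<close>, and
  removes one with each vote that prefers \<open>a\<close> to \<open>b\<close>.
\<close>

lemma kendall_tau_raise_top:
  assumes fin: "finite A" and V: "V \<in> rankings A" and W: "W \<in> rankings A" and a: "a \<in> A"
    and B: "B = {b \<in> A. prefers W b a}"
  shows "int (kendall_tau V (raise_top A a W)) = int (kendall_tau V W) + set_margin [V] B a"
proof -
  let ?D0 = "discordant V (raise_top A a W)" and ?D1 = "discordant V W"
  define U where "U = {b \<in> B. prefers V b a}"
  define L where "L = {b \<in> B. prefers V a b}"
  have finB: "finite B" using fin B by simp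
  then have finUL: "finite U" "finite L" by (simp_all add: U_def L_def)
  have aB: "a \<notin> B" by (simp add: B prefers_def)
  have eq: "?D0 \<union> Pair a ` L = ?D1 \<union> (\<lambda>b. (b, a)) ` U"
  proof (intro set_eqI, clarify)
    fix b c
    have cmp: "prefers W x a \<longleftrightarrow> \<not> prefers W a x" if "x \<in> A" "x \<noteq> a" for x
      using prefers_total[OF W that(1) a that(2)] prefers_asym[OF W] by blast
    show "(b, c) \<in> ?D0 \<union> Pair a ` L \<longleftrightarrow> (b, c) \<in> ?D1 \<union> (\<lambda>b. (b, a)) ` U"
      using cmp[of b] cmp[of c] prefers_in[OF V, of b c] prefers_in[OF W, of c b]
        prefers_irrefl[of V] prefers_irrefl[of W]
      by (cases "b = a"; cases "c = a"; cases "b = c")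
        (auto simp: discordant_def prefers_raise_top U_def L_def B)
  qed
  have disj: "?D0 \<inter> Pair a ` L = {}" "?D1 \<inter> (\<lambda>b. (b, a)) ` U = {}"
    using prefers_asym[OF W] aB
    by (auto simp: discordant_def prefers_raise_top U_def L_def B)
  have "card ?D0 + card L = card (?D0 \<union> Pair a ` L)"
    using disj(1) finUL finite_discordant[OF fin V]
    by (subst card_Un_disjoint) (simp_all add: card_image inj_on_def)
  also have "\<dots> = card ?D1 + card U"
    unfolding eq using disj(2) finUL finite_discordant[OF fin V]
    by (subst card_Un_disjoint) (simp_all add: card_image inj_on_def)
  finally have "card ?D0 + card L = card ?D1 + card U" .
  moreover have "set_margin [V] B a = int (card U) - int (card L)"
    using finB
    by (simp add: set_margin_def margin_Cons sum_subtractf U_def L_def of_bool_def sum.If_cases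
        Int_def)
  ultimately show ?thesis
    by (simp add: kendall_tau_eq_card_discordant[OF V])
qed

section \<open>Swapping two neighbours\<close>

abbreviation swap_ranks :: "'a \<Rightarrow> 'a \<Rightarrow> 'a rel \<Rightarrow> 'a rel" where
  "swap_ranks x y V \<equiv> inv_image V (Transposition.transpose x y)"

lemma prefers_swap_ranks:
  "prefers (swap_ranks x y V) b c \<longleftrightarrow> prefers V (Transposition.transpose x y b) (Transposition.transpose x y c)"
  by (auto simp: prefers_def dest: transpose_eq_imp_eq)

lemma swap_ranks_swap_ranks [simp]: "swap_ranks x y (swap_ranks x y V) = V"
  by (auto simp: inv_image_def)

lemma transpose_in_iff:
  assumes "x \<in> A" "y \<in> A"
  shows "Transposition.transpose x y b \<in> A \<longleftrightarrow> b \<in> A"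
  using assms by (auto simp: Transposition.transpose_def split: if_splits)

lemma swap_ranks_in_rankings:
  assumes "V \<in> rankings A" "x \<in> A" "y \<in> A"
  shows "swap_ranks x y V \<in> rankings A"
proof -
  have "V \<subseteq> A \<times> A" "refl_on A V" "trans V" "antisym V" "total_on A V"
    using assms(1) by (auto simp: rankings_def order_on_defs)
  moreover have "swap_ranks x y V \<subseteq> A \<times> A"
    using \<open>V \<subseteq> A \<times> A\<close> transpose_in_iff[OF assms(2,3)] by auto
  moreover have "refl_on A (swap_ranks x y V)"
    using \<open>refl_on A V\<close> transpose_in_iff[OF assms(2,3)] by (auto simp: refl_on_def)
  moreover have "antisym (swap_ranks x y V)"
    using \<open>antisym V\<close> by (auto simp: antisym_def dest: transpose_eq_imp_eq)
  moreover have "total_on A (swap_ranks x y V)"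
    using \<open>total_on A V\<close> transpose_in_iff[OF assms(2,3)]
    by (auto simp: total_on_def dest: transpose_eq_imp_eq)
  ultimately show ?thesis
    by (simp add: rankings_def order_on_defs trans_inv_image)
qed

text \<open>
  Renaming alternatives leaves the distance unchanged, and a transposition is its own inverse, so it
  can be moved from one argument to the other.
\<close>

lemma kendall_tau_swap_ranks:
  assumes V: "V \<in> rankings A" and xy: "x \<in> A" "y \<in> A"
  shows "kendall_tau (swap_ranks x y V) W = kendall_tau V (swap_ranks x y W)"
proof -
  have "discordant V (swap_ranks x y W)
      = map_prod (Transposition.transpose x y) (Transposition.transpose x y) ` discordant (swap_ranks x y V) W"
  proof (intro set_eqI, clarify)
    fix b c
    let ?t = "Transposition.transpose x y"
    show "(b, c) \<in> discordant V (swap_ranks x y W)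
        \<longleftrightarrow> (b, c) \<in> map_prod ?t ?t ` discordant (swap_ranks x y V) W"
    proof
      assume "(b, c) \<in> discordant V (swap_ranks x y W)"
      then have "(?t b, ?t c) \<in> discordant (swap_ranks x y V) W"
        by (simp add: discordant_def prefers_swap_ranks)
      then show "(b, c) \<in> map_prod ?t ?t ` discordant (swap_ranks x y V) W"
        by (rule rev_image_eqI) simp
    qed (auto simp: discordant_def prefers_swap_ranks)
  qed
  moreover have "inj (map_prod (Transposition.transpose x y) (Transposition.transpose x y))"
    by (intro prod.inj_map) simp_all
  ultimately show ?thesis
    unfolding kendall_tau_eq_card_discordant[OF V]
      kendall_tau_eq_card_discordant[OF swap_ranks_in_rankings[OF V xy]]
    by (simp add: card_image inj_on_subset)
qed

definition adjacent :: "'a rel \<Rightarrow> 'a \<Rightarrow> 'a \<Rightarrow> bool" where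
  "adjacent V x y \<longleftrightarrow> prefers V x y \<and> \<not> (\<exists>z. prefers V x z \<and> prefers V z y)"

text \<open>
  Nothing lies between neighbours, so any third alternative is on the same side of both and only
  the pair itself is reversed.
\<close>

lemma prefers_swap_ranks_adjacent:
  assumes W: "W \<in> rankings A" and adj: "adjacent W x y"
  shows "prefers (swap_ranks x y W) b c \<longleftrightarrow>
    (b = y \<and> c = x) \<or> prefers W b c \<and> \<not> (b = x \<and> c = y)"
proof -
  have xy: "prefers W x y" "x \<in> A" "y \<in> A" "x \<noteq> y"
    using adj prefers_in[OF W] by (auto simp: adjacent_def prefers_def)
  have below: "prefers W x z \<longleftrightarrow> prefers W y z" if "z \<noteq> y" for z
  proof
    assume "prefers W x z"
    then show "prefers W y z"
      using prefers_total[OF W xy(3) _ that[symmetric]] prefers_in[OF W] adj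
      by (auto simp: adjacent_def)
  qed (rule prefers_trans[OF W xy(1)])
  have above: "prefers W z x \<longleftrightarrow> prefers W z y" if "z \<noteq> x" for z
  proof
    assume "prefers W z y"
    then show "prefers W z x"
      using prefers_total[OF W _ xy(2) that] prefers_in[OF W] adj
      by (auto simp: adjacent_def)
  qed (rule prefers_trans[OF W _ xy(1)])
  consider "b = x" "c = x" | "b = x" "c = y" | "b = x" "c \<noteq> x" "c \<noteq> y"
    | "b = y" "c = x" | "b = y" "c = y" | "b = y" "c \<noteq> x" "c \<noteq> y"
    | "b \<noteq> x" "b \<noteq> y" "c = x" | "b \<noteq> x" "b \<noteq> y" "c = y"
    | "b \<noteq> x" "b \<noteq> y" "c \<noteq> x" "c \<noteq> y"
    by blast
  then show ?thesis
    using xy(1,4) prefers_asym[OF W xy(1)] prefers_irrefl[of W] below above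
    by cases (simp_all add: prefers_swap_ranks)
qed

lemma kendall_tau_adjacent_swap:
  assumes fin: "finite A" and V: "V \<in> rankings A" and W: "W \<in> rankings A"
    and adj: "adjacent W x y" and Vxy: "prefers V x y"
  shows "kendall_tau V (swap_ranks x y W) = Suc (kendall_tau V W)"
proof -
  have "discordant V (swap_ranks x y W) = insert (x, y) (discordant V W)"
    using Vxy prefers_asym[OF V Vxy]
    by (auto simp: discordant_def prefers_swap_ranks_adjacent[OF W adj])
  moreover have "(x, y) \<notin> discordant V W"
    using adj prefers_asym[OF W] by (auto simp: discordant_def adjacent_def)
  ultimately show ?thesis
    by (simp add: kendall_tau_eq_card_discordant[OF V] finite_discordant[OF fin V])
qed

text \<open>
  A disagreeing pair with the fewest alternatives between its members is adjacent: if \<open>z\<close> lies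
  between \<open>x\<close> and \<open>y\<close>, then by transitivity \<open>W\<close> also disagrees with \<open>V\<close> on \<open>{x, z}\<close> or on
  \<open>{z, y}\<close>, a closer pair.
\<close>

lemma adjacent_disagreement:
  assumes fin: "finite A" and V: "V \<in> rankings A" and W: "W \<in> rankings A" and ne: "V \<noteq> W"
  obtains x y where "adjacent V x y" "prefers W y x"
proof -
  define between where "between = (\<lambda>(x, y). {z. prefers V x z \<and> prefers V z y})"
  obtain b c where "prefers V b c" "\<not> prefers W b c"
    using rankings_eqI[OF V W] ne by blast
  then have "(b, c) \<in> discordant V W"
    using prefers_total[OF W, of b c] prefers_in[OF V]
    by (auto simp: discordant_def prefers_def)
  then obtain p where p: "p \<in> discordant V W"
    and least: "\<And>q. q \<in> discordant V W \<Longrightarrow> card (between p) \<le> card (between q)"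
    by (metis ex_has_least_nat[of "\<lambda>q. q \<in> discordant V W" _ "\<lambda>q. card (between q)"])
  obtain x y where xy: "p = (x, y)" "prefers V x y" "prefers W y x"
    using p by (auto simp: discordant_def)
  have "\<not> (prefers V x z \<and> prefers V z y)" for z
  proof
    assume z: "prefers V x z \<and> prefers V z y"
    have fin_between: "finite (between (x, y))"
      by (rule finite_subset[OF _ fin]) (use prefers_in[OF V] in \<open>auto simp: between_def\<close>)
    have z_in: "z \<in> between (x, y)" using z by (simp add: between_def)
    have "prefers W z x \<or> prefers W y z"
      using prefers_total[OF W, of x z] prefers_in[OF V] z xy(3) prefers_trans[OF W]
      by metis
    then show False
    proof
      assume "prefers W z x"
      then have "(x, z) \<in> discordant V W" using z by (simp add: discordant_def)
      moreover have "between (x, z) \<subset> between (x, y)"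
      proof
        show "between (x, z) \<subseteq> between (x, y)"
          using z by (auto simp: between_def intro: prefers_trans[OF V])
        have "z \<notin> between (x, z)" by (simp add: between_def prefers_irrefl)
        with z_in show "between (x, z) \<noteq> between (x, y)" by blast
      qed
      ultimately show False
        using least[of "(x, z)"] psubset_card_mono[OF fin_between] xy(1)
        by (meson leD)
    next
      assume "prefers W y z"
      then have "(z, y) \<in> discordant V W" using z by (simp add: discordant_def)
      moreover have "between (z, y) \<subset> between (x, y)"
      proof
        show "between (z, y) \<subseteq> between (x, y)"
          using z by (auto simp: between_def intro: prefers_trans[OF V])
        have "z \<notin> between (z, y)" by (simp add: between_def prefers_irrefl)
        with z_in show "between (z, y) \<noteq> between (x, y)" by blast
      qed
      ultimately show False
        using least[of "(z, y)"] psubset_card_mono[OF fin_between] xy(1)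
        by (meson leD)
    qed
  qed
  with xy have "adjacent V x y" by (auto simp: adjacent_def)
  with xy(3) show ?thesis by (rule that[rotated -1])
qed

section \<open>Expectations under a single vote\<close>

text \<open>
  If the swap keeps \<open>B\<close> invariant, it merely permutes the summands of the margin; otherwise
  \<open>y \<in> B\<close> takes the higher place of \<open>x \<notin> B\<close>, and the comparison of \<open>y\<close> with \<open>a\<close> can only
  turn in favour of \<open>y\<close>.
\<close>

lemma set_margin_swap_ranks_mono:
  assumes fin: "finite B" and V: "V \<in> rankings A" and Vxy: "prefers V x y"
    and a: "x \<noteq> a" "y \<noteq> a" and B: "x \<in> B \<longrightarrow> y \<in> B"
  shows "set_margin [V] B a \<le> set_margin [swap_ranks x y V] B a"
proof -
  define d :: "'a \<Rightarrow> int" where "d b = of_bool (prefers V b a) - of_bool (prefers V a b)" for b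
  let ?t = "Transposition.transpose x y"
  have lhs: "set_margin [V] B a = sum d B"
    by (simp add: set_margin_def margin_Cons d_def)
  have rhs: "set_margin [swap_ranks x y V] B a = (\<Sum>b\<in>B. d (?t b))"
    using a by (simp add: set_margin_def margin_Cons d_def prefers_swap_ranks)
  show ?thesis
  proof (cases "x \<in> B \<longleftrightarrow> y \<in> B")
    case True
    have "bij_betw ?t B B"
      unfolding bij_betw_def using True by (auto intro: inj_onI dest: transpose_eq_imp_eq)
    then have "(\<Sum>b\<in>B. d (?t b)) = sum d B"
      by (rule sum.reindex_bij_betw)
    with lhs rhs show ?thesis by simp
  next
    case False
    with B have xy: "y \<in> B" "x \<notin> B" by auto
    have "d y \<le> d x"
      using prefers_trans[OF V Vxy, of a] prefers_trans[OF V _ Vxy, of a]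
        prefers_asym[OF V, of x a] prefers_asym[OF V, of y a]
      by (auto simp: d_def)
    moreover have "(\<Sum>b\<in>B - {y}. d (?t b)) = sum d (B - {y})"
      using xy by (intro sum.cong refl arg_cong[where f = d] transpose_apply_other) auto
    ultimately show ?thesis
      unfolding lhs rhs using fin xy by (simp add: sum.remove[of B y])
  qed
qed

lemma mallows_Z_pos:
  assumes "finite A" "0 < \<phi>" "W \<in> rankings A"
  shows "0 < mallows_Z A \<phi> W"
  unfolding mallows_Z_def using assms finite_rankings[OF assms(1)] by (intro sum_pos) auto

lemma set_pmf_mallows:
  assumes "finite A" "0 < \<phi>" "W \<in> rankings A"
  shows "set_pmf (mallows A \<phi> W) = rankings A"
  using pmf_mallows[OF assms] assms(2) mallows_Z_pos[OF assms] by (auto simp: set_pmf_eq)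

lemma expectation_mallows:
  assumes "finite A" "0 < \<phi>" "W \<in> rankings A"
  shows "measure_pmf.expectation (mallows A \<phi> W) G
       = (\<Sum>V\<in>rankings A. \<phi> ^ kendall_tau V W * G V) / mallows_Z A \<phi> W"
proof -
  have "measure_pmf.expectation (mallows A \<phi> W) G
      = (\<Sum>V\<in>rankings A. G V * pmf (mallows A \<phi> W) V)"
    by (rule integral_measure_pmf_real) (simp_all add: assms finite_rankings set_pmf_mallows)
  also have "\<dots> = (\<Sum>V\<in>rankings A. \<phi> ^ kendall_tau V W * G V) / mallows_Z A \<phi> W"
    unfolding sum_divide_distrib by (intro sum.cong) (simp_all add: pmf_mallows[OF assms])
  finally show ?thesis .
qed

lemma sum_swap_ranks:
  assumes "x \<in> A" "y \<in> A"
  shows "(\<Sum>V\<in>rankings A. F (swap_ranks x y V)) = (\<Sum>V\<in>rankings A. F V)"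
  by (rule sum.reindex_bij_witness[of _ "swap_ranks x y" "swap_ranks x y"])
    (simp_all add: swap_ranks_in_rankings assms)

text \<open>
  Exchange argument. Write \<open>s\<close> for the swap of \<open>x\<close> and \<open>y\<close>, and \<open>q V\<close> for the weight of \<open>V\<close>
  under \<open>W\<close>; its weight under \<open>s W\<close> is \<open>q (s V)\<close>. Summing over each vote together with its swap,
  twice the unnormalised gain in expectation is the sum of \<open>(q V - q (s V)) * (G (s V) - G V)\<close>. Both
  factors are nonnegative if \<open>V\<close> agrees with \<open>W\<close> on \<open>{x, y}\<close>, and both are nonpositive otherwise.
\<close>

lemma expectation_mallows_adjacent_swap_le:
  fixes G :: "'a rel \<Rightarrow> real"
  assumes fin: "finite A" and \<phi>: "0 < \<phi>" "\<phi> < 1" and W: "W \<in> rankings A"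
    and adj: "adjacent W x y"
    and G: "\<And>V. V \<in> rankings A \<Longrightarrow> prefers V x y \<Longrightarrow> G V \<le> G (swap_ranks x y V)"
  shows "measure_pmf.expectation (mallows A \<phi> W) G
       \<le> measure_pmf.expectation (mallows A \<phi> (swap_ranks x y W)) G"
proof -
  let ?s = "swap_ranks x y"
  have xy: "x \<in> A" "y \<in> A" "x \<noteq> y"
    using adj prefers_in[OF W] by (auto simp: adjacent_def prefers_def)
  define q where "q V = \<phi> ^ kendall_tau V W" for V
  have q_swap: "\<phi> ^ kendall_tau V (?s W) = q (?s V)" if "V \<in> rankings A" for V
    unfolding q_def kendall_tau_swap_ranks[OF that xy(1,2)] ..
  have drop: "q (?s V) \<le> q V" if V: "V \<in> rankings A" and "prefers V x y" for V
    using kendall_tau_adjacent_swap[OF fin V W adj that(2)] \<phi>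
    by (simp add: q_def kendall_tau_swap_ranks[OF V xy(1,2)] mult_left_le_one_le)
  have nonneg: "0 \<le> (q V - q (?s V)) * (G (?s V) - G V)" if V: "V \<in> rankings A" for V
  proof (cases "prefers V x y")
    case True
    then show ?thesis using drop[OF V] G[OF V] by simp
  next
    case False
    have sV: "?s V \<in> rankings A" using V xy by (simp add: swap_ranks_in_rankings)
    have "prefers (?s V) x y"
      using False prefers_total[OF V xy] by (simp add: prefers_swap_ranks)
    then show ?thesis using drop[OF sV] G[OF sV] by (simp add: mult_nonpos_nonpos)
  qed
  have "(\<Sum>V\<in>rankings A. (q V - q (?s V)) * (G (?s V) - G V))
      = (\<Sum>V\<in>rankings A. q (?s (?s V)) * G (?s V)) + (\<Sum>V\<in>rankings A. q (?s V) * G V)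
      - ((\<Sum>V\<in>rankings A. q V * G V) + (\<Sum>V\<in>rankings A. q (?s V) * G (?s V)))"
    by (simp add: algebra_simps sum.distrib sum_subtractf)
  also have "\<dots> = 2 * ((\<Sum>V\<in>rankings A. q (?s V) * G V) - (\<Sum>V\<in>rankings A. q V * G V))"
    using sum_swap_ranks[OF xy(1,2), of "\<lambda>V. q (?s V) * G V"]
      sum_swap_ranks[OF xy(1,2), of "\<lambda>V. q V * G V"] by simp
  finally have le: "(\<Sum>V\<in>rankings A. q V * G V) \<le> (\<Sum>V\<in>rankings A. q (?s V) * G V)"
    using sum_nonneg[of "rankings A" "\<lambda>V. (q V - q (?s V)) * (G (?s V) - G V)"] nonneg by simp
  have "mallows_Z A \<phi> (?s W) = mallows_Z A \<phi> W"
    using sum_swap_ranks[OF xy(1,2), of q] by (simp add: mallows_Z_def q_swap) (simp add: q_def)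
  then show ?thesis
    using le mallows_Z_pos[OF fin \<phi>(1) W] W xy fin \<phi>
    by (simp add: expectation_mallows swap_ranks_in_rankings q_swap divide_right_mono)
      (simp add: q_def divide_right_mono)
qed

text \<open>
  By the hypothesis \<open>above\<close>, a swap towards \<open>h\<^sub>0\<close> never puts a non-member of \<open>B\<close> above a
  member. Such swaps lead from \<open>h\<close> to \<open>h\<^sub>0\<close>, each lowering the distance to \<open>h\<^sub>0\<close> by one.
\<close>

lemma expectation_mallows_top_le:
  fixes g :: "int \<Rightarrow> real"
  assumes fin: "finite A" and \<phi>: "0 < \<phi>" "\<phi> < 1"
    and h\<^sub>0: "h\<^sub>0 \<in> top_rankings A a" and a: "a \<in> A"
    and B: "B \<subseteq> A" and above: "\<And>x y. x \<in> B \<Longrightarrow> y \<in> A - B \<Longrightarrow> y \<noteq> a \<Longrightarrow> prefers h\<^sub>0 x y"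
    and g: "mono g"
    and h: "h \<in> top_rankings A a"
  shows "measure_pmf.expectation (mallows A \<phi> h) (\<lambda>V. g (set_margin [V] B a))
       \<le> measure_pmf.expectation (mallows A \<phi> h\<^sub>0) (\<lambda>V. g (set_margin [V] B a))"
  using h
proof (induction "kendall_tau h h\<^sub>0" arbitrary: h rule: less_induct)
  case less
  let ?E = "\<lambda>W. measure_pmf.expectation (mallows A \<phi> W) (\<lambda>V. g (set_margin [V] B a))"
  have rk: "h \<in> rankings A" "h\<^sub>0 \<in> rankings A"
    using less.prems h\<^sub>0 by (auto simp: top_rankings_def)
  show ?case
  proof (cases "h = h\<^sub>0")
    case False
    then obtain x y where adj: "adjacent h x y" and dis: "prefers h\<^sub>0 y x"
      using adjacent_disagreement[OF fin rk] by metis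
    have hxy: "prefers h x y" using adj by (simp add: adjacent_def)
    have xy: "x \<in> A" "y \<in> A" "x \<noteq> y"
      using prefers_in[OF rk(1) hxy] hxy by (auto simp: prefers_def)
    have xa: "x \<noteq> a" "y \<noteq> a"
      using dis hxy xy less.prems h\<^sub>0 prefers_asym[OF rk(1)] prefers_asym[OF rk(2)]
      by (auto simp: top_rankings_def)
    let ?h = "swap_ranks x y h"
    have rk': "?h \<in> rankings A" using rk xy by (simp add: swap_ranks_in_rankings)
    have top': "?h \<in> top_rankings A a"
      using less.prems rk' xa
      by (auto simp: top_rankings_def prefers_swap_ranks_adjacent[OF rk(1) adj])
    have "discordant ?h h\<^sub>0 = discordant h h\<^sub>0 - {(x, y)}"
      using prefers_asym[OF rk(2) dis]
      by (auto simp: discordant_def prefers_swap_ranks_adjacent[OF rk(1) adj] xy)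
    moreover have "(x, y) \<in> discordant h h\<^sub>0"
      using hxy dis by (simp add: discordant_def)
    ultimately have closer: "kendall_tau ?h h\<^sub>0 < kendall_tau h h\<^sub>0"
      unfolding kendall_tau_eq_card_discordant[OF rk(1)] kendall_tau_eq_card_discordant[OF rk']
      using finite_discordant[OF fin rk(1)] by (metis card_Diff1_less)
    have xB: "x \<in> B \<longrightarrow> y \<in> B"
      using above[of x y] xa xy prefers_asym[OF rk(2) dis] by blast
    have "?E h \<le> ?E ?h"
      using fin \<phi> rk(1) adj
      by (rule expectation_mallows_adjacent_swap_le)
        (intro monoD[OF g] set_margin_swap_ranks_mono; use fin B xa xB in \<open>auto dest: finite_subset\<close>)
    also have "\<dots> \<le> ?E h\<^sub>0"
      using closer top' by (rule less.hyps)
    finally show ?thesis .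
  qed simp
qed

section \<open>Independent votes\<close>

lemma finite_set_replicate_pmf:
  assumes "finite (set_pmf p)"
  shows "finite (set_pmf (replicate_pmf n p))"
  using finite_lists_length_eq[OF assms, of n] by (simp add: set_replicate_pmf lists_eq_set)

lemma expectation_replicate_pmf_Suc:
  fixes F :: "'a list \<Rightarrow> real"
  assumes "finite (set_pmf p)"
  shows "measure_pmf.expectation (replicate_pmf (Suc n) p) F
       = measure_pmf.expectation p (\<lambda>x. measure_pmf.expectation (replicate_pmf n p) (\<lambda>xs. F (x # xs)))"
proof -
  have "measure_pmf.expectation (replicate_pmf (Suc n) p) F
      = measure_pmf.expectation (p \<bind> (\<lambda>x. map_pmf (Cons x) (replicate_pmf n p))) F"
    by (simp add: map_pmf_def)
  also have "\<dots> = (\<Sum>x\<in>set_pmf p. pmf p x *\<^sub>R measure_pmf.expectation (replicate_pmf n p) (\<lambda>xs. F (x # xs)))"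
    using assms by (subst pmf_expectation_bind[of "set_pmf p"]) (simp_all add: finite_set_replicate_pmf)
  also have "\<dots> = measure_pmf.expectation p (\<lambda>x. measure_pmf.expectation (replicate_pmf n p) (\<lambda>xs. F (x # xs)))"
    using assms by (subst integral_measure_pmf[of "set_pmf p"]) simp_all
  finally show ?thesis .
qed

lemma expectation_mono_finite:
  fixes f g :: "'a \<Rightarrow> real"
  assumes "finite (set_pmf p)" and "\<And>x. x \<in> set_pmf p \<Longrightarrow> f x \<le> g x"
  shows "measure_pmf.expectation p f \<le> measure_pmf.expectation p g"
  using assms by (intro integral_mono_AE integrable_measure_pmf_finite) (auto simp: AE_measure_pmf_iff)

text \<open>
  The hypothesis \<open>dom\<close> is stochastic dominance in terms of all nondecreasing functions. This form
  makes the induction work: it applies to \<open>g\<close> shifted by one summand, and to the average of \<open>g\<close>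
  over the remaining summands.
\<close>

lemma expectation_replicate_pmf_stochastic_mono:
  fixes w :: "'a \<Rightarrow> int" and g :: "int \<Rightarrow> real"
  assumes fin: "finite (set_pmf p)" "finite (set_pmf q)"
    and dom: "\<And>g :: int \<Rightarrow> real. mono g \<Longrightarrow>
      measure_pmf.expectation p (\<lambda>x. g (w x)) \<le> measure_pmf.expectation q (\<lambda>x. g (w x))"
    and g: "mono g"
  shows "measure_pmf.expectation (replicate_pmf n p) (\<lambda>xs. g (sum_list (map w xs)))
       \<le> measure_pmf.expectation (replicate_pmf n q) (\<lambda>xs. g (sum_list (map w xs)))"
  using g
proof (induction n arbitrary: g)
  case (Suc n)
  let ?E = "\<lambda>r v. measure_pmf.expectation (replicate_pmf n r) (\<lambda>xs. g (v + sum_list (map w xs)))"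
  have shift: "mono (\<lambda>u. g (v + u))" for v
    using Suc.prems by (auto simp: mono_def)
  have "measure_pmf.expectation p (\<lambda>x. ?E p (w x)) \<le> measure_pmf.expectation p (\<lambda>x. ?E q (w x))"
    by (intro expectation_mono_finite fin Suc.IH shift)
  also have "\<dots> \<le> measure_pmf.expectation q (\<lambda>x. ?E q (w x))"
    by (intro dom monoI expectation_mono_finite finite_set_replicate_pmf fin monoD[OF Suc.prems]) simp
  finally show ?case
    by (simp only: expectation_replicate_pmf_Suc[OF fin(1)] expectation_replicate_pmf_Suc[OF fin(2)]
        list.map sum_list.Cons)
qed simp

lemma pmf_replicate_pmf:
  "length xs = n \<Longrightarrow> pmf (replicate_pmf n p) xs = prod_list (map (pmf p) xs)"
proof (induction n arbitrary: xs)
  case (Suc n)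
  then obtain y ys where xs: "xs = y # ys" "length ys = n" by (auto simp: length_Suc_conv)
  have "replicate_pmf (Suc n) p = map_pmf (\<lambda>(x, xs). x # xs) (pair_pmf p (replicate_pmf n p))"
    by (simp add: pair_pmf_def map_bind_pmf)
  moreover have "inj (\<lambda>(x, xs). x # xs)" by (auto simp: inj_on_def)
  ultimately have "pmf (replicate_pmf (Suc n) p) (y # ys) = pmf (pair_pmf p (replicate_pmf n p)) (y, ys)"
    using pmf_map_inj'[of "\<lambda>(x, xs). x # xs" _ "(y, ys)"] by simp
  with xs Suc.IH show ?case by (simp add: pmf_pair)
qed simp

section \<open>Most powerful tests\<close>

text \<open>
  At every point \<open>(f - g) * (q - c * p)\<close> is nonnegative, since \<open>f\<close> takes its largest possible
  value where the second factor is positive and its smallest where it is negative. Summation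
  bounds the difference in power from below by \<open>c\<close> times the difference in size.
\<close>

lemma neyman_pearson:
  fixes f g :: "'s \<Rightarrow> real"
  assumes fin: "finite S" and supp: "set_pmf p \<subseteq> S" "set_pmf q \<subseteq> S" and c: "0 \<le> c"
    and g: "\<And>x. x \<in> S \<Longrightarrow> 0 \<le> g x \<and> g x \<le> 1"
    and reject: "\<And>x. x \<in> S \<Longrightarrow> c * pmf p x < pmf q x \<Longrightarrow> f x = 1"
    and accept: "\<And>x. x \<in> S \<Longrightarrow> pmf q x < c * pmf p x \<Longrightarrow> f x = 0"
    and size: "measure_pmf.expectation p g \<le> measure_pmf.expectation p f"
  shows "measure_pmf.expectation q g \<le> measure_pmf.expectation q f"
proof -
  have E: "measure_pmf.expectation r u = (\<Sum>x\<in>S. u x * pmf r x)" if "set_pmf r \<subseteq> S" for r u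
    using that by (intro integral_measure_pmf_real fin) auto
  have "0 \<le> (f x - g x) * (pmf q x - c * pmf p x)" if "x \<in> S" for x
    using g[OF that] reject[OF that] accept[OF that]
    by (cases "c * pmf p x" "pmf q x" rule: linorder_cases) (auto simp: mult_nonpos_nonpos mult_nonneg_nonpos)
  then have "0 \<le> (\<Sum>x\<in>S. (f x - g x) * (pmf q x - c * pmf p x))"
    by (rule sum_nonneg)
  also have "\<dots> = measure_pmf.expectation q f - measure_pmf.expectation q g
      - c * (measure_pmf.expectation p f - measure_pmf.expectation p g)"
    by (simp add: E supp algebra_simps sum.distrib sum_subtractf sum_distrib_left)
  finally show ?thesis
    using mult_nonneg_nonneg[OF c, of "measure_pmf.expectation p f - measure_pmf.expectation p g"] size
    by simp
qed

text \<open>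
  Take the least \<open>k\<close> whose upper tail \<open>T > k\<close> has probability at most \<open>\<alpha>\<close>. By minimality the tail
  together with the atom \<open>T = k\<close> has probability above \<open>\<alpha>\<close>, so rejecting on the correct fraction of
  the atom attains \<open>\<alpha>\<close> exactly.
\<close>

lemma ex_critical_value:
  fixes T :: "'s \<Rightarrow> int"
  assumes fin: "finite (set_pmf p)" and \<alpha>: "0 < \<alpha>" "\<alpha> < 1"
  obtains k :: int and \<Gamma> :: real where "0 \<le> \<Gamma>" "\<Gamma> \<le> 1"
    "measure_pmf.expectation p (\<lambda>x. if T x > k then 1 else if T x < k then 0 else \<Gamma>) = \<alpha>"
proof -
  define tail where "tail k = measure_pmf.prob p {x. T x > k}" for k
  \<comment> \<open>one below the minimum, so that the upper tail at \<open>lo\<close> is everything\<close>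
  define lo where "lo = Min (T ` set_pmf p) - 1"
  have lo: "lo < T x" if "x \<in> set_pmf p" for x
    using Min_le[OF finite_imageI[OF fin, of T], of "T x"] that by (simp add: lo_def)
  define hi where "hi = Max (T ` set_pmf p)"
  have hi: "T x \<le> hi" if "x \<in> set_pmf p" for x
    using Max_ge[OF finite_imageI[OF fin, of T], of "T x"] that by (simp add: hi_def)
  have tail_lo: "tail lo = 1"
    unfolding tail_def using lo by (intro measure_pmf.prob_eq_1[THEN iffD2]) (auto simp: AE_measure_pmf_iff)
  have tail_hi: "tail hi = 0"
    unfolding tail_def using hi by (auto simp: measure_pmf_zero_iff disjoint_iff not_less)
  have "lo \<le> hi"
    using lo hi set_pmf_not_empty[of p] by fastforce
  then have "tail (lo + int (nat (hi - lo))) \<le> \<alpha>"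
    using tail_hi \<alpha> by simp
  then obtain j where j: "tail (lo + int j) \<le> \<alpha>" and least: "\<And>i. i < j \<Longrightarrow> \<not> tail (lo + int i) \<le> \<alpha>"
    using exists_least_iff[of "\<lambda>j. tail (lo + int j) \<le> \<alpha>"] by blast
  have "j \<noteq> 0" using j tail_lo \<alpha> by (intro notI) simp
  define k where "k = lo + int j"
  have "\<alpha> < tail (k - 1)"
    using least[of "j - 1"] \<open>j \<noteq> 0\<close> by (simp add: k_def of_nat_diff algebra_simps)
  moreover have "tail (k - 1) = tail k + measure_pmf.prob p {x. T x = k}"
    unfolding tail_def by (subst measure_pmf.finite_measure_Union[symmetric]) (auto intro: arg_cong[where f = "measure_pmf.prob p"])
  moreover have "tail k \<le> \<alpha>" using j by (simp add: k_def)
  ultimately have gap: "0 < measure_pmf.prob p {x. T x = k}" "\<alpha> - tail k \<le> measure_pmf.prob p {x. T x = k}"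
    by linarith+
  define \<Gamma> where "\<Gamma> = (\<alpha> - tail k) / measure_pmf.prob p {x. T x = k}"
  have "measure_pmf.expectation p (\<lambda>x. if T x > k then 1 else if T x < k then 0 else \<Gamma>)
      = measure_pmf.expectation p (\<lambda>x. indicator {x. T x > k} x + \<Gamma> * indicator {x. T x = k} x)"
    by (intro Bochner_Integration.integral_cong) (auto simp: indicator_def)
  also have "\<dots> = tail k + \<Gamma> * measure_pmf.prob p {x. T x = k}"
    using fin by (subst Bochner_Integration.integral_add) (auto simp: tail_def intro: integrable_measure_pmf_finite)
  also have "\<dots> = \<alpha>" using gap by (simp add: \<Gamma>_def)
  finally show ?thesis
    using that[of \<Gamma> k] gap \<open>tail k \<le> \<alpha>\<close> by (simp add: \<Gamma>_def)
qed

section \<open>The margin test\<close>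

lemma set_margin_eq_sum_list: "set_margin P B a = sum_list (map (\<lambda>V. set_margin [V] B a) P)"
proof (induction P)
  case (Cons V P)
  then show ?case by (simp add: set_margin_Cons[of V P])
qed simp

lemma finite_profiles: "finite A \<Longrightarrow> finite (profiles A n)"
  unfolding profiles_def by (intro finite_lists_length_eq finite_rankings)

lemma set_pmf_mallows_model:
  assumes "finite A" "0 < \<phi>" "W \<in> rankings A"
  shows "set_pmf (mallows_model A \<phi> n W) = profiles A n"
  by (auto simp: mallows_model_def set_replicate_pmf set_pmf_mallows[OF assms] profiles_def)

lemma finite_top_rankings: "finite A \<Longrightarrow> finite (top_rankings A a)"
  using finite_rankings[of A] by (simp add: top_rankings_def)

text \<open>
  The votes are independent, so the ratio is a product over single votes. For one vote it is a
  constant times \<open>\<phi>\<close> to the difference of the two distances, which \<open>kendall_tau_raise_top\<close>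
  identifies with the negated margin.
\<close>

lemma mallows_model_likelihood_ratio:
  assumes fin: "finite A" and \<phi>: "0 < \<phi>" and W: "W \<in> rankings A" and a: "a \<in> A"
    and B: "B = {b \<in> A. prefers W b a}" and P: "P \<in> profiles A n"
  shows "pmf (mallows_model A \<phi> n W) P
    = (mallows_Z A \<phi> (raise_top A a W) / mallows_Z A \<phi> W) ^ n
      * \<phi> powr - real_of_int (set_margin P B a)
      * pmf (mallows_model A \<phi> n (raise_top A a W)) P"
proof -
  let ?W0 = "raise_top A a W"
  let ?C = "mallows_Z A \<phi> ?W0 / mallows_Z A \<phi> W"
  have W0: "?W0 \<in> rankings A"
    using raise_top_in_top_rankings[OF W a] by (simp add: top_rankings_def)
  have Z: "0 < mallows_Z A \<phi> W" "0 < mallows_Z A \<phi> ?W0"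
    using mallows_Z_pos[OF fin \<phi>] W W0 by auto
  have vote: "pmf (mallows A \<phi> W) V
      = ?C * \<phi> powr - real_of_int (set_margin [V] B a) * pmf (mallows A \<phi> ?W0) V"
    if V: "V \<in> rankings A" for V
  proof -
    have "real (kendall_tau V W) = - real_of_int (set_margin [V] B a) + real (kendall_tau V ?W0)"
      using kendall_tau_raise_top[OF fin V W a B] by linarith
    then have "\<phi> ^ kendall_tau V W = \<phi> powr - real_of_int (set_margin [V] B a) * \<phi> ^ kendall_tau V ?W0"
      using \<phi> by (simp add: powr_realpow[symmetric] powr_add[symmetric])
    then show ?thesis
      using Z V by (simp add: pmf_mallows[OF fin \<phi>] W W0)
  qed
  have "prod_list (map (pmf (mallows A \<phi> W)) P)
      = ?C ^ length P * \<phi> powr - real_of_int (set_margin P B a)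
        * prod_list (map (pmf (mallows A \<phi> ?W0)) P)"
    if "set P \<subseteq> rankings A" for P
    using that
  proof (induction P)
    case (Cons V P)
    have "\<phi> powr - real_of_int (set_margin (V # P) B a)
        = \<phi> powr - real_of_int (set_margin [V] B a) * \<phi> powr - real_of_int (set_margin P B a)"
      using \<phi> by (simp add: set_margin_Cons[of V P] powr_add[symmetric])
    with Cons vote[of V] show ?case by simp
  qed (use \<phi> in simp)
  with P show ?thesis
    by (simp add: profiles_def mallows_model_def pmf_replicate_pmf)
qed

lemma test_size_eqI:
  assumes "finite H" and "h\<^sub>0 \<in> H" and "\<And>h. h \<in> H \<Longrightarrow> size_at \<pi> f h \<le> size_at \<pi> f h\<^sub>0"
  shows "test_size \<pi> H f = size_at \<pi> f h\<^sub>0"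
  unfolding test_size_def
  by (rule antisym) (use assms in \<open>auto intro!: cSUP_least cSUP_upper bdd_above_finite\<close>)

lemma size_at_le_test_size:
  assumes "finite H" and "h \<in> H"
  shows "size_at \<pi> f h \<le> test_size \<pi> H f"
  unfolding test_size_def using assms by (auto intro!: cSUP_upper bdd_above_finite)

text \<open>
  The ranking \<open>raise_top A a W\<close> is least favourable: the test is a nondecreasing function of the
  total margin, and this ranking places every member of \<open>B\<close> above every other alternative
  apart from \<open>a\<close>, so it maximises the margin stochastically.
\<close>

lemma test_size_margin_test:
  assumes fin: "finite A" and \<phi>: "0 < \<phi>" "\<phi> < 1" and W: "W \<in> rankings A" and a: "a \<in> A"
    and B: "B = {b \<in> A. prefers W b a}" and \<Gamma>: "0 \<le> \<Gamma>" "\<Gamma> \<le> 1"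
  shows "test_size (mallows_model A \<phi> n) (top_rankings A a) (margin_test a B K \<Gamma>)
       = size_at (mallows_model A \<phi> n) (margin_test a B K \<Gamma>) (raise_top A a W)"
proof (rule test_size_eqI)
  let ?W0 = "raise_top A a W"
  show top: "?W0 \<in> top_rankings A a"
    by (rule raise_top_in_top_rankings[OF W a])
  fix h assume h: "h \<in> top_rankings A a"
  define g :: "int \<Rightarrow> real"
    where "g u = (if real_of_int u > K then 1 else if real_of_int u < K then 0 else \<Gamma>)" for u
  have "mono g"
    using \<Gamma> by (auto simp: mono_def g_def)
  have test: "margin_test a B K \<Gamma> = (\<lambda>P. g (sum_list (map (\<lambda>V. set_margin [V] B a) P)))"
    by (simp add: fun_eq_iff margin_test_def g_def set_margin_eq_sum_list[symmetric])
  have above: "prefers ?W0 x y" if "x \<in> B" "y \<in> A - B" "y \<noteq> a" for x y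
    using that prefers_total[OF W, of y a] prefers_trans[OF W, of x a y] a B
    by (auto simp: prefers_raise_top prefers_irrefl)
  have rk: "h \<in> rankings A" "?W0 \<in> rankings A"
    using h top by (auto simp: top_rankings_def)
  show "size_at (mallows_model A \<phi> n) (margin_test a B K \<Gamma>) h
      \<le> size_at (mallows_model A \<phi> n) (margin_test a B K \<Gamma>) ?W0"
    unfolding size_at_def mallows_model_def test
  proof (rule expectation_replicate_pmf_stochastic_mono[OF _ _ _ \<open>mono g\<close>])
    show "measure_pmf.expectation (mallows A \<phi> h) (\<lambda>V. g' (set_margin [V] B a))
        \<le> measure_pmf.expectation (mallows A \<phi> ?W0) (\<lambda>V. g' (set_margin [V] B a))"
      if "mono g'" for g' :: "int \<Rightarrow> real"
      using fin \<phi> top a _ above that h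
      by (rule expectation_mallows_top_le) (auto simp: B)
  qed (simp_all add: set_pmf_mallows[OF fin \<phi>(1)] rk finite_rankings fin)
qed (rule finite_top_rankings[OF fin])

text \<open>
  Since \<open>\<phi> < 1\<close>, the likelihood ratio of \<open>W\<close> to \<open>raise_top A a W\<close> is a strictly increasing function
  of the margin, so a threshold on the margin is a threshold on the ratio.
\<close>

lemma margin_test_power_maximal:
  assumes fin: "finite A" and \<phi>: "0 < \<phi>" "\<phi> < 1" and W: "W \<in> rankings A" and a: "a \<in> A"
    and B: "B = {b \<in> A. prefers W b a}"
    and g: "is_test (profiles A n) g"
    and size: "size_at (mallows_model A \<phi> n) g (raise_top A a W)
      \<le> size_at (mallows_model A \<phi> n) (margin_test a B K \<Gamma>) (raise_top A a W)"
  shows "power_at (mallows_model A \<phi> n) g W \<le> power_at (mallows_model A \<phi> n) (margin_test a B K \<Gamma>) W"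
proof -
  let ?W0 = "raise_top A a W"
  let ?p = "mallows_model A \<phi> n ?W0" and ?q = "mallows_model A \<phi> n W"
  let ?C = "(mallows_Z A \<phi> ?W0 / mallows_Z A \<phi> W) ^ n"
  have W0: "?W0 \<in> rankings A"
    using raise_top_in_top_rankings[OF W a] by (simp add: top_rankings_def)
  have C: "0 \<le> ?C"
    using mallows_Z_pos[OF fin \<phi>(1) W] mallows_Z_pos[OF fin \<phi>(1) W0] by simp
  have below: "pmf ?q P \<le> ?C * \<phi> powr - K * pmf ?p P"
    if "P \<in> profiles A n" "real_of_int (set_margin P B a) \<le> K" for P
    unfolding mallows_model_likelihood_ratio[OF fin \<phi>(1) W a B that(1)]
    using C \<phi> that(2) by (intro mult_right_mono mult_left_mono powr_mono') auto
  have above: "?C * \<phi> powr - K * pmf ?p P \<le> pmf ?q P"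
    if "P \<in> profiles A n" "K \<le> real_of_int (set_margin P B a)" for P
    unfolding mallows_model_likelihood_ratio[OF fin \<phi>(1) W a B that(1)]
    using C \<phi> that(2) by (intro mult_right_mono mult_left_mono powr_mono') auto
  show ?thesis
    unfolding power_at_def
  proof (rule neyman_pearson[where S = "profiles A n" and p = ?p and c = "?C * \<phi> powr - K"])
    show "measure_pmf.expectation ?p g \<le> measure_pmf.expectation ?p (margin_test a B K \<Gamma>)"
      using size by (simp add: size_at_def)
    show "margin_test a B K \<Gamma> P = 1"
      if "P \<in> profiles A n" "?C * \<phi> powr - K * pmf ?p P < pmf ?q P" for P
      using below[OF that(1)] that(2) by (auto simp: margin_test_def)
    show "margin_test a B K \<Gamma> P = 0"
      if "P \<in> profiles A n" "pmf ?q P < ?C * \<phi> powr - K * pmf ?p P" for P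
      using above[OF that(1)] that(2) by (auto simp: margin_test_def)
  qed (use C g in \<open>auto simp: is_test_def finite_profiles[OF fin] set_pmf_mallows_model[OF fin \<phi>(1)] W W0\<close>)
qed

theorem theorem1:
  fixes A :: "'a set" and \<phi> \<alpha> :: real and n :: nat and a :: 'a
    and h\<^sub>1 :: "'a rel" and B :: "'a set"
  assumes "finite A" and "card A \<ge> 2"
    and "0 < \<phi>" and "\<phi> < 1"
    and "n \<ge> 1"
    and "a \<in> A"
    and "h\<^sub>1 \<in> rankings A" and "h\<^sub>1 \<notin> top_rankings A a"
    and "0 < \<alpha>" and "\<alpha> < 1"
    and "B = {b \<in> A. prefers h\<^sub>1 b a}"
  shows "(\<exists>K \<Gamma>. 0 \<le> \<Gamma> \<and> \<Gamma> \<le> 1 \<and>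
            test_size (mallows_model A \<phi> n) (top_rankings A a) (margin_test a B K \<Gamma>) = \<alpha>) \<and>
         (\<forall>K \<Gamma>. 0 \<le> \<Gamma> \<and> \<Gamma> \<le> 1 \<and>
            test_size (mallows_model A \<phi> n) (top_rankings A a) (margin_test a B K \<Gamma>) = \<alpha> \<longrightarrow>
            ump_test (profiles A n) (mallows_model A \<phi> n) (top_rankings A a) {h\<^sub>1} \<alpha>
              (margin_test a B K \<Gamma>))"
proof (intro conjI allI impI; (elim conjE)?)
  let ?W0 = "raise_top A a h\<^sub>1" and ?M = "mallows_model A \<phi> n"
  note size_eq = test_size_margin_test[OF assms(1,3,4,7,6,11)]
  have top: "?W0 \<in> top_rankings A a"
    by (rule raise_top_in_top_rankings[OF assms(7,6)])
  then have "finite (set_pmf (?M ?W0))"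
    using assms by (simp add: set_pmf_mallows_model finite_profiles top_rankings_def)
  then obtain k :: int and \<Gamma> where \<Gamma>: "0 \<le> \<Gamma>" "\<Gamma> \<le> 1"
    and E: "measure_pmf.expectation (?M ?W0)
      (\<lambda>P. if set_margin P B a > k then 1 else if set_margin P B a < k then 0 else \<Gamma>) = \<alpha>"
    using assms(9,10) by (rule ex_critical_value[where T = "\<lambda>P. set_margin P B a"])
  have "size_at ?M (margin_test a B (real_of_int k) \<Gamma>) ?W0 = \<alpha>"
    unfolding E[symmetric] size_at_def
    by (intro Bochner_Integration.integral_cong) (simp_all add: margin_test_def)
  with \<Gamma> show "\<exists>K \<Gamma>. 0 \<le> \<Gamma> \<and> \<Gamma> \<le> 1
      \<and> test_size ?M (top_rankings A a) (margin_test a B K \<Gamma>) = \<alpha>"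
    by (metis size_eq)
  fix K \<Gamma> :: real
  assume \<Gamma>: "0 \<le> \<Gamma>" "\<Gamma> \<le> 1"
    and size: "test_size ?M (top_rankings A a) (margin_test a B K \<Gamma>) = \<alpha>"
  have "power_at ?M g h\<^sub>1 \<le> power_at ?M (margin_test a B K \<Gamma>) h\<^sub>1"
    if g: "is_test (profiles A n) g" "test_size ?M (top_rankings A a) g \<le> \<alpha>" for g
  proof (rule margin_test_power_maximal[OF assms(1,3,4,7,6,11) g(1)])
    have "size_at ?M g ?W0 \<le> test_size ?M (top_rankings A a) g"
      using size_at_le_test_size[OF finite_top_rankings[OF assms(1)] top] .
    with g(2) show "size_at ?M g ?W0 \<le> size_at ?M (margin_test a B K \<Gamma>) ?W0"
      using size size_eq[OF \<Gamma>] by simp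
  qed
  then show "ump_test (profiles A n) ?M (top_rankings A a) {h\<^sub>1} \<alpha> (margin_test a B K \<Gamma>)"
    using assms(8) \<Gamma> size by (auto simp: ump_test_def is_test_def margin_test_def)
qed

end
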